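(* Let $f\in C^{1,1}(\mathbb{R})$ with $L_f:=\|f'\|_\infty<\infty$ and let $L'_f$ be the Lipschitz constant of $f'$. Let $L>L_f$, set $D:=\frac{2LL_f}{L^2-L_f^2}$, and let $\delta>0$ satisfy $$\delta\,L'_f\,(1+D^2)^{3/2}<L\qquad\text{and}\qquad \delta\,L^2L'_f<(L^2-L_f^2)^{3/2}.$$ Then the function $$u(x,d):=\sup_{y\in\mathbb{R}}\left[f(y)-L\sqrt{(x-y)^2+d^2}\right]$$ is $\infty$-harmonic in the strip $\{(x,d)\in\mathbb{R}^2:0<d<\delta\}$.
   Context: $C^{1,1}(\mathbb{R})$ denotes the differentiable functions $f:\mathbb{R}\to\mathbb{R}$ whose derivative $f'$ is bounded and globally Lipschitz. A continuous function $u$ on an open set $\Omega\subset\mathbb{R}^2$ is called $\infty$-harmonic if it is a viscosity solution in $\Omega$ of the infinity-Laplace equation $\Delta_\infty u=\sum_{i,j}u_{x_i}u_{x_j}u_{x_ix_j}=0$ (equivalently, $u$ is an absolutely minimizing Lipschitz function in $\Omega$). *)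

theory Defs
  imports "HOL-Analysis.Analysis"
begin

definition C11 :: "(real \<Rightarrow> real) \<Rightarrow> bool" where
  "C11 f \<longleftrightarrow> (\<forall>x. f differentiable (at x)) \<and> bounded (range (deriv f))
     \<and> (\<exists>K. K-lipschitz_on UNIV (deriv f))"

definition sup_norm :: "(real \<Rightarrow> real) \<Rightarrow> real" where
  "sup_norm g = (SUP x. \<bar>g x\<bar>)"

(* The least Lipschitz constant; meaningful for globally Lipschitz g only. *)
definition lip_const :: "(real \<Rightarrow> real) \<Rightarrow> real" where
  "lip_const g = Inf {K. K-lipschitz_on UNIV g}"

definition partial :: "'a::euclidean_space \<Rightarrow> ('a \<Rightarrow> real) \<Rightarrow> 'a \<Rightarrow> real" where
  "partial i \<phi> x = frechet_derivative \<phi> (at x) i"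

(* Differentiability of the first partial derivatives already makes them continuous,
   so this is the usual class C^2 on an open set. *)
definition C2_on :: "'a::euclidean_space set \<Rightarrow> ('a \<Rightarrow> real) \<Rightarrow> bool" where
  "C2_on \<Omega> \<phi> \<longleftrightarrow>
     (\<forall>x\<in>\<Omega>. \<phi> differentiable (at x)) \<and>
     (\<forall>i\<in>Basis. \<forall>x\<in>\<Omega>. partial i \<phi> differentiable (at x)) \<and>
     (\<forall>i\<in>Basis. \<forall>j\<in>Basis. continuous_on \<Omega> (partial j (partial i \<phi>)))"

definition inf_laplacian :: "('a::euclidean_space \<Rightarrow> real) \<Rightarrow> 'a \<Rightarrow> real" where
  "inf_laplacian \<phi> x =
     (\<Sum>i\<in>Basis. \<Sum>j\<in>Basis. partial i \<phi> x * partial j \<phi> x * partial j (partial i \<phi>) x)"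

definition viscosity_subsolution :: "'a::euclidean_space set \<Rightarrow> ('a \<Rightarrow> real) \<Rightarrow> bool" where
  "viscosity_subsolution \<Omega> u \<longleftrightarrow>
     (\<forall>\<phi>. \<forall>p\<in>\<Omega>. C2_on \<Omega> \<phi> \<longrightarrow>
        (\<forall>\<^sub>F q in nhds p. u q - \<phi> q \<le> u p - \<phi> p) \<longrightarrow> inf_laplacian \<phi> p \<ge> 0)"

definition viscosity_supersolution :: "'a::euclidean_space set \<Rightarrow> ('a \<Rightarrow> real) \<Rightarrow> bool" where
  "viscosity_supersolution \<Omega> u \<longleftrightarrow>
     (\<forall>\<phi>. \<forall>p\<in>\<Omega>. C2_on \<Omega> \<phi> \<longrightarrow>
        (\<forall>\<^sub>F q in nhds p. u q - \<phi> q \<ge> u p - \<phi> p) \<longrightarrow> inf_laplacian \<phi> p \<le> 0)"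

definition inf_harmonic_on :: "'a::euclidean_space set \<Rightarrow> ('a \<Rightarrow> real) \<Rightarrow> bool" where
  "inf_harmonic_on \<Omega> u \<longleftrightarrow>
     open \<Omega> \<and> continuous_on \<Omega> u \<and> viscosity_subsolution \<Omega> u \<and> viscosity_supersolution \<Omega> u"

end

theory Submission
  imports Defs
begin

text \<open>
  The value \<open>u (x, d)\<close> is the height over \<open>(x, d)\<close> of the upper envelope of the downward cones of
  slope \<open>L\<close> with apex \<open>f y\<close> over \<open>(y, 0)\<close>. As a supremum of such cones, \<open>u\<close> is \<open>L\<close>-Lipschitz.
  A function with this property is \<open>\<infinity>\<close>-harmonic as soon as every point \<open>p\<close> is interior to a segment
  on which the function is affine with the extreme slope \<open>L\<close>
  (\<open>inf_harmonic_on_if_maximal_slope_segments\<close>): if \<open>e\<close> is the direction of the segment and \<open>\<phi>\<close> is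
  a smooth function touching \<open>u\<close> at \<open>p\<close>, then the Lipschitz bound and the slope along \<open>e\<close> force
  \<open>D\<phi>(p) = L e\<close>, so that the infinity Laplacian of \<open>\<phi>\<close> at \<open>p\<close> is \<open>L\<^sup>2\<close> times the second derivative
  of \<open>\<phi>\<close> along the segment. There \<open>u\<close> is affine, so the sign of this second derivative is decided by
  the side from which \<open>\<phi>\<close> touches.

  For the envelope, the segment lies on the ray from \<open>(y, 0)\<close> through \<open>p\<close>, where \<open>y\<close> is the vertex
  of a highest cone over \<open>p\<close>. Towards the vertex the envelope rises with slope \<open>L\<close> in any case. In
  the opposite direction it could stay above the cone, namely if another cone took over. A vertex
  \<open>y\<close> of a highest cone over \<open>(x, d)\<close> satisfies \<open>x = y - d h (f' y)\<close> with
  \<open>h s = s / sqrt (L\<^sup>2 - s\<^sup>2)\<close>, which is the vanishing of the derivative with respect to \<open>y\<close>. On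
  slopes bounded by \<open>L\<^sub>f\<close>, \<open>h\<close> has Lipschitz constant \<open>L\<^sup>2 / (L\<^sup>2 - L\<^sub>f\<^sup>2) powr (3/2)\<close>. The smallness
  of \<open>\<delta>\<close> therefore makes \<open>y \<mapsto> d h (f' y)\<close> a strict contraction for \<open>d < \<delta>\<close>, and \<open>x\<close> and \<open>d\<close>
  determine the vertex (\<open>critical_vertex_unique\<close>). Since \<open>y\<close> stays critical all along its ray, it
  remains the vertex of the highest cone until the ray leaves the strip.
\<close>

section \<open>Second-order tests along a segment of maximal slope\<close>

definition gradient :: "('a::euclidean_space \<Rightarrow> real) \<Rightarrow> 'a \<Rightarrow> 'a" where
  "gradient \<phi> x = (\<Sum>i\<in>Basis. partial i \<phi> x *\<^sub>R i)"

lemma inner_gradient: "gradient \<phi> x \<bullet> v = (\<Sum>i\<in>Basis. partial i \<phi> x * (v \<bullet> i))"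
  by (simp add: gradient_def inner_sum_left inner_commute[of v])

lemma has_derivative_gradient:
  fixes \<phi> :: "'a::euclidean_space \<Rightarrow> real"
  assumes "\<phi> differentiable (at x)"
  shows "(\<phi> has_derivative (\<lambda>v. gradient \<phi> x \<bullet> v)) (at x)"
proof -
  let ?F = "frechet_derivative \<phi> (at x)"
  have F: "(\<phi> has_derivative ?F) (at x)"
    using assms by (simp add: frechet_derivative_works)
  have lin: "linear ?F"
    using F by (rule has_derivative_linear)
  have "?F v = gradient \<phi> x \<bullet> v" for v
  proof -
    have "?F v = ?F (\<Sum>i\<in>Basis. (v \<bullet> i) *\<^sub>R i)"
      by (simp only: euclidean_representation)
    also have "\<dots> = (\<Sum>i\<in>Basis. ?F i * (v \<bullet> i))"
      by (simp add: linear_sum[OF lin] linear_cmul[OF lin] mult.commute)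
    finally show ?thesis
      by (simp only: inner_gradient partial_def)
  qed
  then have "?F = (\<lambda>v. gradient \<phi> x \<bullet> v)" by (rule ext)
  with F show ?thesis by (rule subst[rotated])
qed

lemma has_real_derivative_along_line:
  fixes \<phi> :: "'a::euclidean_space \<Rightarrow> real"
  assumes "\<phi> differentiable (at (p + t *\<^sub>R v))"
  shows "((\<lambda>t. \<phi> (p + t *\<^sub>R v)) has_real_derivative gradient \<phi> (p + t *\<^sub>R v) \<bullet> v) (at t)"
proof -
  have "((\<lambda>t. p + t *\<^sub>R v) has_derivative (\<lambda>h. h *\<^sub>R v)) (at t)"
    by (auto intro!: derivative_eq_intros)
  from has_derivative_compose[OF this has_derivative_gradient[OF assms]]
  show ?thesis
    by (simp add: has_field_derivative_def mult_commute_abs)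
qed

lemma second_derivative_nonneg_at_local_min:
  fixes g g' :: "real \<Rightarrow> real"
  assumes min: "\<forall>\<^sub>F t in nhds 0. g 0 \<le> g t"
    and deriv: "\<forall>\<^sub>F t in nhds 0. (g has_real_derivative g' t) (at t)"
    and deriv2: "(g' has_real_derivative c) (at 0)"
  shows "g' 0 = 0" "c \<ge> 0"
proof -
  have "\<exists>d>0. \<forall>t. \<bar>t\<bar> < d \<longrightarrow> g 0 \<le> g t \<and> (g has_real_derivative g' t) (at t)"
    using eventually_conj[OF min deriv] by (simp add: eventually_nhds_metric)
  then obtain d where d: "d > 0" "\<And>t. \<bar>t\<bar> < d \<Longrightarrow> g 0 \<le> g t"
    "\<And>t. \<bar>t\<bar> < d \<Longrightarrow> (g has_real_derivative g' t) (at t)"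
    by blast
  show g'0: "g' 0 = 0"
    using DERIV_local_min[of g "g' 0" 0 d] d by auto
  show "c \<ge> 0"
  proof (rule ccontr)
    assume "\<not> c \<ge> 0"
    then obtain e where e: "e > 0" "\<And>h. 0 < h \<Longrightarrow> h < e \<Longrightarrow> g' h < 0"
      using DERIV_neg_dec_right[OF deriv2] g'0 by auto
    define b where "b = min d e / 2"
    have b: "0 < b" "b < d" "b < e"
      using d e by (auto simp: b_def min_def)
    obtain z where z: "0 < z" "z < b" "g b - g 0 = (b - 0) * g' z"
      using MVT2[of 0 b g g'] b d(3) by auto
    have "g' z < 0" using e z b by auto
    then have "(b - 0) * g' z < 0" using b by (simp add: mult_pos_neg)
    then have "g b < g 0" using z by linarith
    with d(2)[of b] b show False by auto
  qed
qed

lemma eventually_along_line: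
  fixes p v :: "'a::real_normed_vector"
  assumes "\<forall>\<^sub>F q in nhds p. P q"
  shows "\<forall>\<^sub>F t in nhds (0::real). P (p + t *\<^sub>R v)"
proof -
  have "((\<lambda>t. p + t *\<^sub>R v) \<longlongrightarrow> p + 0 *\<^sub>R v) (nhds (0::real))"
    by (intro tendsto_intros filterlim_ident)
  then have "filterlim (\<lambda>t. p + t *\<^sub>R v) (nhds p) (nhds (0::real))"
    by simp
  then show ?thesis
    using assms by (rule eventually_compose_filterlim[rotated])
qed

text \<open>
  Moving from \<open>p\<close> in the direction of \<open>- D\<phi>(p)\<close>, the test function decreases at the rate
  \<open>|D\<phi>(p)|\<close>. It stays above \<open>u\<close> up to a constant, and \<open>u\<close> decreases at most at the rate \<open>L\<close>.
\<close>

lemma gradient_norm_le_if_touches_lipschitz: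
  fixes u \<phi> :: "'a::euclidean_space \<Rightarrow> real"
  assumes diff: "\<phi> differentiable (at p)"
    and touch: "\<forall>\<^sub>F q in nhds p. u q - \<phi> q \<le> u p - \<phi> p"
    and lip: "L-lipschitz_on UNIV u"
  shows "norm (gradient \<phi> p) \<le> L"
proof (rule ccontr)
  assume less: "\<not> norm (gradient \<phi> p) \<le> L"
  define G where "G = gradient \<phi> p"
  have G: "norm G > L" "norm G > 0"
    using less lipschitz_on_nonneg[OF lip] by (auto simp: G_def)
  let ?k = "\<lambda>t. \<phi> (p + t *\<^sub>R (- G)) + L * norm G * t"
  have "((\<lambda>t. \<phi> (p + t *\<^sub>R (- G))) has_real_derivative G \<bullet> (- G)) (at 0)"
    using has_real_derivative_along_line[of \<phi> p 0 "- G"] diff by (simp add: G_def)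
  then have "(?k has_real_derivative norm G * (L - norm G)) (at 0)"
    by (auto intro!: derivative_eq_intros
        simp: power2_norm_eq_inner[symmetric] power2_eq_square algebra_simps)
  moreover have "norm G * (L - norm G) < 0"
    using G by (simp add: mult_pos_neg)
  ultimately obtain d where d: "d > 0" "\<And>h. 0 < h \<Longrightarrow> h < d \<Longrightarrow> ?k h < ?k 0"
    using DERIV_neg_dec_right[of ?k _ 0] by force
  have "\<exists>d>0. \<forall>t. \<bar>t\<bar> < d \<longrightarrow>
      u (p + t *\<^sub>R (- G)) - \<phi> (p + t *\<^sub>R (- G)) \<le> u p - \<phi> p"
    using eventually_along_line[OF touch, of "- G"] by (simp add: eventually_nhds_metric)
  then obtain d' where d': "d' > 0"
    "\<And>t. \<bar>t\<bar> < d' \<Longrightarrow> u (p + t *\<^sub>R (- G)) - \<phi> (p + t *\<^sub>R (- G)) \<le> u p - \<phi> p"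
    by blast
  define h where "h = min d d' / 2"
  have h: "0 < h" "h < d" "h < d'"
    using d d' by (auto simp: h_def min_def)
  have "\<bar>u (p + h *\<^sub>R (- G)) - u p\<bar> \<le> L * (h * norm G)"
    using lipschitz_onD[OF lip, of "p + h *\<^sub>R (- G)" p] h by (simp add: dist_norm)
  moreover have "\<phi> (p + h *\<^sub>R (- G)) + L * norm G * h < \<phi> p"
    using d(2)[of h] h by simp
  moreover have "u (p + h *\<^sub>R (- G)) - \<phi> (p + h *\<^sub>R (- G)) \<le> u p - \<phi> p"
    using d'(2)[of h] h by simp
  ultimately show False
    by (simp add: algebra_simps)
qed

text \<open>
  The difference of \<open>\<phi>\<close> and the affine function \<open>t \<mapsto> L t\<close> has a local minimum at \<open>t = 0\<close> along the
  segment, which fixes the first derivative and the sign of the second one. The first derivative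
  being as large as the gradient bound permits, the whole gradient is \<open>L e\<close>, and the infinity
  Laplacian sees only the second derivative along the segment.
\<close>

lemma inf_laplacian_nonneg_if_touches_above:
  fixes u \<phi> :: "'a::euclidean_space \<Rightarrow> real"
  assumes "open \<Omega>" "p \<in> \<Omega>" and C2: "C2_on \<Omega> \<phi>"
    and touch: "\<forall>\<^sub>F q in nhds p. u q - \<phi> q \<le> u p - \<phi> p"
    and lip: "L-lipschitz_on UNIV u"
    and e: "norm e = 1"
    and slope: "\<forall>\<^sub>F t in nhds 0. u (p + t *\<^sub>R e) = u p + L * t"
  shows "inf_laplacian \<phi> p \<ge> 0"
proof -
  define G where "G = gradient \<phi> p"
  define c where
    "c = (\<Sum>i\<in>Basis. (\<Sum>j\<in>Basis. partial j (partial i \<phi>) p * (e \<bullet> j)) * (e \<bullet> i))"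
  let ?g = "\<lambda>t. \<phi> (p + t *\<^sub>R e) - L * t"
  let ?g' = "\<lambda>t. gradient \<phi> (p + t *\<^sub>R e) \<bullet> e - L"
  have "\<forall>\<^sub>F t in nhds 0. ?g 0 \<le> ?g t"
    using slope eventually_along_line[OF touch, of e] by eventually_elim simp
  moreover have "\<forall>\<^sub>F t in nhds 0. (?g has_real_derivative ?g' t) (at t)"
  proof -
    have "\<forall>\<^sub>F t in nhds 0. p + t *\<^sub>R e \<in> \<Omega>"
      using assms(1,2) by (intro eventually_along_line eventually_nhds_in_open)
    then show ?thesis
      by eventually_elim
        (use C2 in \<open>auto intro!: derivative_eq_intros has_real_derivative_along_line
          simp: C2_on_def\<close>)
  qed
  moreover have "(?g' has_real_derivative c) (at 0)"
  proof -
    have "((\<lambda>t. partial i \<phi> (p + t *\<^sub>R e)) has_real_derivative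
        (\<Sum>j\<in>Basis. partial j (partial i \<phi>) p * (e \<bullet> j))) (at 0)" if "i \<in> Basis" for i
      using has_real_derivative_along_line[of "partial i \<phi>" p 0 e] C2 that assms(2)
      by (simp add: C2_on_def inner_gradient)
    then have "((\<lambda>t. \<Sum>i\<in>Basis. partial i \<phi> (p + t *\<^sub>R e) * (e \<bullet> i)) has_real_derivative c) (at 0)"
      unfolding c_def by (auto intro!: DERIV_sum DERIV_cmult_right)
    from DERIV_diff[OF this DERIV_const[of L]] show ?thesis
      by (simp add: inner_gradient)
  qed
  ultimately have Ge: "?g' 0 = 0" and c: "c \<ge> 0"
    by (rule second_derivative_nonneg_at_local_min)+
  from Ge have Ge: "G \<bullet> e = L" by (simp add: G_def)
  have normG: "norm G \<le> L"
    unfolding G_def using C2 assms(2) touch lip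
    by (intro gradient_norm_le_if_touches_lipschitz) (auto simp: C2_on_def)
  \<comment> \<open>Equality in Cauchy-Schwarz: a vector of length at most \<open>L\<close> whose component along the unit
    vector \<open>e\<close> is \<open>L\<close> equals \<open>L e\<close>.\<close>
  have "(norm (G - L *\<^sub>R e))\<^sup>2 = (norm G)\<^sup>2 - L\<^sup>2"
    using e Ge
    by (simp add: power2_norm_eq_inner inner_diff_left inner_diff_right inner_commute
        power2_eq_square[of L] norm_eq_1)
  also have "\<dots> \<le> 0"
    using normG by (simp add: power_mono)
  finally have "G = L *\<^sub>R e" by simp
  then have partial: "partial i \<phi> p = L * (e \<bullet> i)" if "i \<in> Basis" for i
    using inner_gradient[of \<phi> p i] that by (simp add: G_def inner_Basis if_distrib cong: if_cong)
  have "inf_laplacian \<phi> p = L\<^sup>2 * c"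
    unfolding inf_laplacian_def c_def
    by (auto simp: partial sum_distrib_left sum_distrib_right power2_eq_square algebra_simps
        intro!: sum.cong)
  with c show ?thesis by simp
qed

lemma partial_uminus:
  assumes "\<phi> differentiable (at x)"
  shows "partial i (\<lambda>x. - \<phi> x) x = - partial i \<phi> x"
proof -
  have "((\<lambda>x. - \<phi> x) has_derivative (\<lambda>v. - frechet_derivative \<phi> (at x) v)) (at x)"
    using assms by (intro has_derivative_minus) (simp add: frechet_derivative_works)
  from frechet_derivative_at[OF this] show ?thesis
    unfolding partial_def by metis
qed

lemma C2_on_uminus_and_inf_laplacian_uminus:
  fixes \<phi> :: "'a::euclidean_space \<Rightarrow> real"
  assumes "open \<Omega>" and C2: "C2_on \<Omega> \<phi>"
  shows "C2_on \<Omega> (\<lambda>x. - \<phi> x)"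
    and "x \<in> \<Omega> \<Longrightarrow> inf_laplacian (\<lambda>x. - \<phi> x) x = - inf_laplacian \<phi> x"
proof -
  have p1: "partial i (\<lambda>x. - \<phi> x) x = - partial i \<phi> x" if "x \<in> \<Omega>" for x i
    using C2 that by (intro partial_uminus) (auto simp: C2_on_def)
  \<comment> \<open>The first partial derivatives are known to be opposite on \<open>\<Omega>\<close> only; differentiating this
    identity again uses that \<open>\<Omega>\<close> is open.\<close>
  have dp: "(partial i (\<lambda>x. - \<phi> x) has_derivative (\<lambda>v. - frechet_derivative (partial i \<phi>) (at x) v)) (at x)"
    if "x \<in> \<Omega>" "i \<in> Basis" for x i
  proof -
    have "(partial i \<phi> has_derivative frechet_derivative (partial i \<phi>) (at x)) (at x)"
      using C2 that by (simp add: C2_on_def frechet_derivative_works[symmetric])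
    then have "((\<lambda>x. - partial i \<phi> x) has_derivative (\<lambda>v. - frechet_derivative (partial i \<phi>) (at x) v)) (at x)"
      by (rule has_derivative_minus)
    then show ?thesis
      using assms(1) that(1) by (rule has_derivative_transform_within_open) (simp add: p1)
  qed
  have p2: "partial j (partial i (\<lambda>x. - \<phi> x)) x = - partial j (partial i \<phi>) x"
    if "x \<in> \<Omega>" "i \<in> Basis" for x i j
    using frechet_derivative_at[OF dp[OF that]] by (metis partial_def)
  show "C2_on \<Omega> (\<lambda>x. - \<phi> x)"
    unfolding C2_on_def
  proof (intro conjI ballI)
    show "(\<lambda>x. - \<phi> x) differentiable at x" if "x \<in> \<Omega>" for x
      using C2 that by (auto simp: C2_on_def)
    show "partial i (\<lambda>x. - \<phi> x) differentiable at x" if "i \<in> Basis" "x \<in> \<Omega>" for i x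
      using dp that by (auto simp: differentiable_def)
    show "continuous_on \<Omega> (partial j (partial i (\<lambda>x. - \<phi> x)))"
      if "i \<in> Basis" "j \<in> Basis" for i j
    proof -
      have "continuous_on \<Omega> (\<lambda>x. - partial j (partial i \<phi>) x)"
        using C2 that by (auto simp: C2_on_def intro!: continuous_intros)
      then show ?thesis
        by (rule continuous_on_eq) (simp add: p2 that)
    qed
  qed
  show "inf_laplacian (\<lambda>x. - \<phi> x) x = - inf_laplacian \<phi> x" if "x \<in> \<Omega>"
    unfolding inf_laplacian_def using that by (simp add: p1 p2 sum_negf)
qed

text \<open>
  The hypotheses are invariant under replacing \<open>u\<close> by \<open>- u\<close> and \<open>e\<close> by \<open>- e\<close>, which exchanges touching
  from above with touching from below. The supersolution property is thus the subsolution
  property of \<open>- u\<close>.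
\<close>

theorem inf_harmonic_on_if_maximal_slope_segments:
  fixes u :: "'a::euclidean_space \<Rightarrow> real"
  assumes "open \<Omega>" and lip: "L-lipschitz_on UNIV u"
    and slope: "\<And>p. p \<in> \<Omega> \<Longrightarrow> \<exists>e. norm e = 1 \<and> (\<forall>\<^sub>F t in nhds 0. u (p + t *\<^sub>R e) = u p + L * t)"
  shows "inf_harmonic_on \<Omega> u"
  unfolding inf_harmonic_on_def
proof (intro conjI)
  show "open \<Omega>" by fact
  show "continuous_on \<Omega> u"
    using lipschitz_on_continuous_on[OF lip] continuous_on_subset by blast
  show "viscosity_subsolution \<Omega> u"
    unfolding viscosity_subsolution_def
    using inf_laplacian_nonneg_if_touches_above[OF assms(1) _ _ _ lip] slope by blast
  show "viscosity_supersolution \<Omega> u"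
    unfolding viscosity_supersolution_def
  proof (intro allI ballI impI)
    fix \<phi> p
    assume p: "p \<in> \<Omega>" and C2: "C2_on \<Omega> \<phi>" and touch: "\<forall>\<^sub>F q in nhds p. u p - \<phi> p \<le> u q - \<phi> q"
    obtain e where e: "norm e = 1" "\<forall>\<^sub>F t in nhds 0. u (p + t *\<^sub>R e) = u p + L * t"
      using slope[OF p] by blast
    have "0 \<le> inf_laplacian (\<lambda>x. - \<phi> x) p"
    proof (rule inf_laplacian_nonneg_if_touches_above[OF assms(1) p])
      show "C2_on \<Omega> (\<lambda>x. - \<phi> x)"
        using assms(1) C2 by (rule C2_on_uminus_and_inf_laplacian_uminus)
      show "\<forall>\<^sub>F q in nhds p. - u q - - \<phi> q \<le> - u p - - \<phi> p"
        using touch by eventually_elim simp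
      show "L-lipschitz_on UNIV (\<lambda>q. - u q)"
        using lip by simp
      show "norm (- e) = 1" using e by simp
      have "filterlim uminus (nhds 0) (nhds (0::real))"
        using tendsto_minus[OF filterlim_ident[of "nhds (0::real)"]] by simp
      from eventually_compose_filterlim[OF e(2) this]
      show "\<forall>\<^sub>F t in nhds 0. - u (p + t *\<^sub>R (- e)) = - u p + L * t"
        by eventually_elim simp
    qed
    then show "inf_laplacian \<phi> p \<le> 0"
      using C2_on_uminus_and_inf_laplacian_uminus(2)[OF assms(1) C2 p] by simp
  qed
qed

section \<open>Upper envelopes of cones with vertices on the axis\<close>

lemma has_real_derivative_div_sqrt:
  fixes L s :: real
  assumes "s\<^sup>2 < L\<^sup>2"
  shows "((\<lambda>s. s / sqrt (L\<^sup>2 - s\<^sup>2)) has_real_derivative L\<^sup>2 / sqrt (L\<^sup>2 - s\<^sup>2) ^ 3) (at s)"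
proof -
  define w where "w = sqrt (L\<^sup>2 - s\<^sup>2)"
  have w: "w > 0" "w\<^sup>2 = L\<^sup>2 - s\<^sup>2" using assms by (auto simp: w_def)
  have "((\<lambda>s. s / sqrt (L\<^sup>2 - s\<^sup>2)) has_real_derivative
      (1 * w - s * (inverse w / 2 * (0 - 2 * s))) / (w * w)) (at s)"
    using assms unfolding w_def by (auto intro!: derivative_eq_intros)
  moreover have "(1 * w - s * (inverse w / 2 * (0 - 2 * s))) / (w * w) = (w\<^sup>2 + s\<^sup>2) / w ^ 3"
    using w(1) by (simp add: field_simps power2_eq_square power3_eq_cube)
  ultimately show ?thesis
    using w by (simp add: w_def)
qed

text \<open>
  The derivative computed above increases with \<open>|s|\<close>, so on \<open>|s| \<le> M\<close> it is largest at the endpoints.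
\<close>

lemma div_sqrt_lipschitz:
  fixes L M a b :: real
  assumes "0 \<le> M" "M < L" "\<bar>a\<bar> \<le> M" "\<bar>b\<bar> \<le> M"
  shows "\<bar>a / sqrt (L\<^sup>2 - a\<^sup>2) - b / sqrt (L\<^sup>2 - b\<^sup>2)\<bar> \<le> L\<^sup>2 / sqrt (L\<^sup>2 - M\<^sup>2) ^ 3 * \<bar>a - b\<bar>"
proof -
  have M: "M\<^sup>2 < L\<^sup>2" using assms by (simp add: power_strict_mono)
  have s: "s\<^sup>2 \<le> M\<^sup>2" if "s \<in> {-M..M}" for s
    using that by (auto simp: abs_le_square_iff[symmetric])
  have "norm (a / sqrt (L\<^sup>2 - a\<^sup>2) - b / sqrt (L\<^sup>2 - b\<^sup>2)) \<le> L\<^sup>2 / sqrt (L\<^sup>2 - M\<^sup>2) ^ 3 * norm (a - b)"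
  proof (rule field_differentiable_bound)
    show "convex {-M..M}" by simp
    fix s assume s': "s \<in> {-M..M}"
    then have "s\<^sup>2 < L\<^sup>2" using s M by fastforce
    then show "((\<lambda>s. s / sqrt (L\<^sup>2 - s\<^sup>2)) has_field_derivative L\<^sup>2 / sqrt (L\<^sup>2 - s\<^sup>2) ^ 3) (at s within {-M..M})"
      by (rule has_field_derivative_at_within[OF has_real_derivative_div_sqrt])
    have "sqrt (L\<^sup>2 - M\<^sup>2) ^ 3 \<le> sqrt (L\<^sup>2 - s\<^sup>2) ^ 3"
      using s[OF s'] M by (intro power_mono) auto
    then show "norm (L\<^sup>2 / sqrt (L\<^sup>2 - s\<^sup>2) ^ 3) \<le> L\<^sup>2 / sqrt (L\<^sup>2 - M\<^sup>2) ^ 3"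
      using \<open>s\<^sup>2 < L\<^sup>2\<close> M by (auto intro!: divide_left_mono mult_pos_pos)
  qed (use assms in auto)
  then show ?thesis by simp
qed

lemma powr_three_halves:
  fixes a :: real
  assumes "a \<ge> 0"
  shows "a powr (3/2) = sqrt a ^ 3"
proof -
  have "a powr (3/2) = (a powr (1/2)) powr 3"
    by (simp add: powr_powr)
  then show ?thesis
    using assms by (simp add: powr_half_sqrt)
qed

text \<open>
  Seen from the point at distance \<open>d\<close> from the axis, the ray to a critical vertex makes an angle with
  the normal of the axis whose sine is \<open>s / L\<close>; hence the offset \<open>z\<close> along the axis is \<open>d\<close> times the
  tangent \<open>s / sqrt (L\<^sup>2 - s\<^sup>2)\<close> of that angle.
\<close>

lemma vertex_offset_of_critical_point:
  fixes L s d z :: real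
  assumes "\<bar>s\<bar> < L" "d \<ge> 0" and crit: "s * sqrt (z\<^sup>2 + d\<^sup>2) = L * z"
  shows "z = d * (s / sqrt (L\<^sup>2 - s\<^sup>2))"
proof -
  define r where "r = sqrt (z\<^sup>2 + d\<^sup>2)"
  define w where "w = sqrt (L\<^sup>2 - s\<^sup>2)"
  have L: "L > 0" and "s\<^sup>2 < L\<^sup>2"
    using assms(1) abs_le_square_iff[of L s] by linarith+
  then have w: "w > 0" "w\<^sup>2 = L\<^sup>2 - s\<^sup>2" by (auto simp: w_def)
  have r: "r \<ge> 0" "r\<^sup>2 = z\<^sup>2 + d\<^sup>2" by (auto simp: r_def)
  have sr: "s * r = L * z" using crit by (simp add: r_def)
  have "(r * w)\<^sup>2 = L\<^sup>2 * r\<^sup>2 - (s * r)\<^sup>2"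
    unfolding power_mult_distrib w(2) by (simp add: algebra_simps)
  also have "\<dots> = (L * d)\<^sup>2"
    unfolding sr r(2) power_mult_distrib by (simp add: algebra_simps)
  finally have "r * w = L * d"
    by (rule power2_eq_imp_eq) (use r(1) w(1) L \<open>d \<ge> 0\<close> in auto)
  then have "L * (z * w) = L * (d * s)"
    by (simp add: mult.assoc[symmetric] sr[symmetric])
  then show ?thesis
    using L w(1) by (simp add: w_def[symmetric] field_simps)
qed

text \<open>
  The vertex is the last argument, so that maximising over the cones above a given point means
  maximising the function \<open>cone_height f L p\<close>.
\<close>

definition cone_height :: "(real \<Rightarrow> real) \<Rightarrow> real \<Rightarrow> real \<times> real \<Rightarrow> real \<Rightarrow> real" where
  "cone_height f L p y = f y - L * dist p (y, 0)"

lemma cone_height_lipschitz: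
  assumes "L \<ge> 0"
  shows "\<bar>cone_height f L p y - cone_height f L q y\<bar> \<le> L * dist p q"
proof -
  have "\<bar>dist q (y, 0) - dist p (y, 0)\<bar> \<le> dist p q"
    by (metis abs_dist_diff_le dist_commute)
  then have "L * \<bar>dist q (y, 0) - dist p (y, 0)\<bar> \<le> L * dist p q"
    using assms by (rule mult_left_mono)
  then show ?thesis
    using assms by (simp add: cone_height_def abs_mult flip: right_diff_distrib)
qed

lemma highest_cone_exists:
  fixes f :: "real \<Rightarrow> real"
  assumes f: "M-lipschitz_on UNIV f" and "M < L"
  obtains y where "\<And>z. cone_height f L p z \<le> cone_height f L p y"
proof -
  obtain x d where p: "p = (x, d)" by force
  define R where "R = L * \<bar>d\<bar> / (L - M)"
  have R: "R \<ge> 0" "(L - M) * R = L * \<bar>d\<bar>"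
    using assms lipschitz_on_nonneg[OF f] by (auto simp: R_def)
  have "continuous_on {x - R..x + R} f"
    using lipschitz_on_continuous_on[OF f] continuous_on_subset by blast
  then have "continuous_on {x - R..x + R} (cone_height f L p)"
    unfolding cone_height_def by (intro continuous_intros)
  then have "\<exists>y\<in>{x - R..x + R}. \<forall>z\<in>{x - R..x + R}. cone_height f L p z \<le> cone_height f L p y"
    using R(1) by (intro continuous_attains_sup) auto
  then obtain y where y: "\<And>z. z \<in> {x - R..x + R} \<Longrightarrow> cone_height f L p z \<le> cone_height f L p y"
    by blast
  have "cone_height f L p z \<le> cone_height f L p y" for z
  proof (cases "z \<in> {x - R..x + R}")
    case True
    then show ?thesis by (rule y)
  next
    \<comment> \<open>Far from \<open>x\<close>, the slope \<open>L\<close> beats the growth rate \<open>M\<close> of \<open>f\<close>, and the cone with vertex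
      \<open>(x, 0)\<close> is at least as high; \<open>R\<close> is the distance at which this happens.\<close>
    case False
    then have z: "\<bar>z - x\<bar> \<ge> R" by auto
    have "\<bar>z - x\<bar> \<le> dist p (z, 0)"
      using dist_fst_le[of p "(z, 0)"] by (simp add: p dist_real_def)
    then have "L * \<bar>z - x\<bar> \<le> L * dist p (z, 0)"
      using assms lipschitz_on_nonneg[OF f] by (intro mult_left_mono) auto
    moreover have "\<bar>f z - f x\<bar> \<le> M * \<bar>z - x\<bar>"
      using lipschitz_onD[OF f, of z x] by (simp add: dist_real_def)
    moreover have "(L - M) * R \<le> (L - M) * \<bar>z - x\<bar>"
      using z assms by (intro mult_left_mono) auto
    ultimately have "cone_height f L p z \<le> f x - L * \<bar>d\<bar>"
      unfolding cone_height_def R(2) by (simp add: left_diff_distrib)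
    also have "\<dots> = cone_height f L p x"
      by (simp add: cone_height_def p dist_Pair_Pair)
    also have "\<dots> \<le> cone_height f L p y"
      using R(1) by (intro y) auto
    finally show ?thesis .
  qed
  then show thesis by (rule that)
qed

text \<open>
  At the maximum, the derivative of \<open>z \<mapsto> cone_height f L (x, d) z\<close> vanishes; it exists because
  \<open>d > 0\<close> keeps the point away from all vertices.
\<close>

lemma highest_cone_critical:
  fixes f :: "real \<Rightarrow> real"
  assumes f: "(f has_real_derivative s) (at y)" and "d > 0"
    and max: "\<And>z. cone_height f L (x, d) z \<le> cone_height f L (x, d) y"
  shows "s * dist (x, d) (y, 0) = L * (y - x)"
proof -
  let ?r = "dist (x, d) (y, 0)"
  have r: "?r = sqrt ((x - y)\<^sup>2 + d\<^sup>2)" "(x - y)\<^sup>2 + d\<^sup>2 > 0"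
    using \<open>d > 0\<close> by (auto simp: dist_Pair_Pair dist_real_def add_nonneg_pos)
  then have "?r > 0" by simp
  have "cone_height f L (x, d) = (\<lambda>z. f z - L * sqrt ((x - z)\<^sup>2 + d\<^sup>2))"
    by (simp add: fun_eq_iff cone_height_def dist_Pair_Pair dist_real_def)
  moreover have "((\<lambda>z. f z - L * sqrt ((x - z)\<^sup>2 + d\<^sup>2)) has_real_derivative
      s - L * (inverse ?r / 2 * (2 * (x - y) * (0 - 1)))) (at y)"
    unfolding r(1) using f r(2) by (auto intro!: derivative_eq_intros)
  ultimately have "s - L * (inverse ?r / 2 * (2 * (x - y) * (0 - 1))) = 0"
    using max by (metis DERIV_local_max zero_less_one)
  then show ?thesis
    using \<open>?r > 0\<close> by (simp add: field_simps)
qed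

text \<open>
  Two critical vertices \<open>y\<close> and \<open>z\<close> of the same point \<open>(x, d)\<close> differ by
  \<open>d (h (f' y) - h (f' z))\<close> with \<open>h s = s / sqrt (L\<^sup>2 - s\<^sup>2)\<close>, and the bound on \<open>d\<close> makes this smaller
  than \<open>|y - z|\<close> unless \<open>y = z\<close>.
\<close>

lemma critical_vertex_unique:
  fixes f' :: "real \<Rightarrow> real"
  assumes K: "K-lipschitz_on UNIV f'" and M: "\<And>y. \<bar>f' y\<bar> \<le> M" "M < L"
    and d: "0 \<le> d" "d * L\<^sup>2 * K < (L\<^sup>2 - M\<^sup>2) powr (3/2)"
    and y: "f' y * dist (x, d) (y, 0) = L * (y - x)"
    and z: "f' z * dist (x, d) (z, 0) = L * (z - x)"
  shows "y = z"
proof (rule ccontr)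
  assume "y \<noteq> z"
  have M0: "0 \<le> M" using M(1)[of 0] by linarith
  have M2: "M\<^sup>2 < L\<^sup>2" using M0 M(2) by (simp add: power_strict_mono)
  define h where "h = (\<lambda>s. s / sqrt (L\<^sup>2 - s\<^sup>2))"
  define m where "m = sqrt (L\<^sup>2 - M\<^sup>2) ^ 3"
  have m: "m > 0" "d * L\<^sup>2 * K < m"
    using M2 d(2) by (auto simp: m_def powr_three_halves)
  have offset: "v = x + d * h (f' v)" if "f' v * dist (x, d) (v, 0) = L * (v - x)" for v
  proof -
    have "\<bar>f' v\<bar> < L" using M(1)[of v] M(2) by linarith
    moreover have "f' v * sqrt ((v - x)\<^sup>2 + d\<^sup>2) = L * (v - x)"
      using that d(1) by (simp add: dist_Pair_Pair dist_real_def power2_commute[of x])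
    ultimately have "v - x = d * h (f' v)"
      unfolding h_def using d(1) by (intro vertex_offset_of_critical_point)
    then show ?thesis by simp
  qed
  have "\<bar>y - z\<bar> = d * \<bar>h (f' y) - h (f' z)\<bar>"
    using offset[OF y] offset[OF z] d(1)
    by (metis add_diff_cancel_left abs_mult abs_of_nonneg right_diff_distrib)
  also have "\<dots> \<le> d * (L\<^sup>2 / m * \<bar>f' y - f' z\<bar>)"
    unfolding h_def m_def using d(1) M0 M by (intro mult_left_mono div_sqrt_lipschitz) auto
  also have "\<dots> \<le> d * (L\<^sup>2 / m * (K * \<bar>y - z\<bar>))"
    using lipschitz_onD[OF K, of y z] d(1) m(1)
    by (intro mult_left_mono) (auto simp: dist_real_def)
  also have "\<dots> = (d * L\<^sup>2 * K) / m * \<bar>y - z\<bar>"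
    by simp
  also have "\<dots> < 1 * \<bar>y - z\<bar>"
    using m \<open>y \<noteq> z\<close> by (intro mult_strict_right_mono) auto
  finally show False by simp
qed

text \<open>
  Sliding the point along the ray from the vertex \<open>y\<close> of its highest cone keeps \<open>y\<close> critical, and by
  uniqueness of critical vertices the highest cone over each nearby point of the ray still has vertex
  \<open>y\<close>. On the ray, \<open>u\<close> therefore coincides with that single cone, whose slope towards the vertex
  is \<open>L\<close>.
\<close>

lemma highest_cone_has_slope_segment:
  fixes f f' :: "real \<Rightarrow> real" and u :: "real \<times> real \<Rightarrow> real"
  assumes f: "\<And>y. (f has_real_derivative f' y) (at y)"
    and K: "K-lipschitz_on UNIV f'" and M: "\<And>y. \<bar>f' y\<bar> \<le> M" "M < L"
    and d\<^sub>1: "d\<^sub>1 * L\<^sup>2 * K < (L\<^sup>2 - M\<^sup>2) powr (3/2)"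
    and d: "0 < d" "d < d\<^sub>1"
    and u: "\<And>p. \<exists>y. u p = cone_height f L p y \<and> (\<forall>z. cone_height f L p z \<le> cone_height f L p y)"
  shows "\<exists>e. norm e = 1 \<and> (\<forall>\<^sub>F t in nhds 0. u ((x, d) + t *\<^sub>R e) = u (x, d) + L * t)"
proof -
  obtain y where y: "u (x, d) = cone_height f L (x, d) y" "\<And>z. cone_height f L (x, d) z \<le> cone_height f L (x, d) y"
    using u by blast
  define r where "r = dist (x, d) (y, 0)"
  have r: "r > 0" using d(1) by (simp add: r_def)
  have crit: "f' y * r = L * (y - x)"
    unfolding r_def using f d(1) y(2) by (rule highest_cone_critical)
  define e where "e = (1 / r) *\<^sub>R ((y, 0) - (x, d))"
  have norm_e: "norm e = 1"
  proof -
    have "norm ((y, 0) - (x, d)) = r"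
      by (simp only: r_def dist_norm norm_minus_commute)
    then show ?thesis
      unfolding e_def norm_scaleR using r by simp
  qed
  have "\<forall>\<^sub>F t in nhds 0. t < r"
    using eventually_nhds_in_open[of "{..<r}" 0] r by simp
  moreover have "\<forall>\<^sub>F t in nhds 0. snd ((x, d) + t *\<^sub>R e) < d\<^sub>1"
  proof -
    have "\<forall>\<^sub>F q in nhds (x, d). q \<in> UNIV \<times> {..<d\<^sub>1}"
      using d(2) by (intro eventually_nhds_in_open open_Times) auto
    from eventually_along_line[OF this] show ?thesis
      by eventually_elim (simp add: mem_Times_iff)
  qed
  ultimately have "\<forall>\<^sub>F t in nhds 0. u ((x, d) + t *\<^sub>R e) = u (x, d) + L * t"
  proof eventually_elim
    case (elim t)
    \<comment> \<open>The point at signed distance \<open>t\<close> along \<open>e\<close> is the image of \<open>(x, d)\<close> under the homothety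
      with centre \<open>(y, 0)\<close> and factor \<open>c\<close>.\<close>
    define c where "c = 1 - t / r"
    define x' where "x' = y + c * (x - y)"
    have c: "c > 0" "c * r = r - t" using elim r by (auto simp: c_def field_simps)
    have q: "(x, d) + t *\<^sub>R e = (x', c * d)"
      using r by (simp add: e_def c_def x'_def field_simps)
    have dist_q: "dist (x', c * d) (y, 0) = c * r"
    proof -
      have "(x', c * d) - (y, 0) = c *\<^sub>R ((x, d) - (y, 0))"
        by (simp add: x'_def)
      then show ?thesis
        using c(1) by (simp only: dist_norm norm_scaleR r_def abs_of_pos)
    qed
    have d': "0 < c * d" "c * d < d\<^sub>1"
      using c(1) d(1) elim(2) unfolding q by auto
    obtain z where z: "u (x', c * d) = cone_height f L (x', c * d) z"
      "\<And>v. cone_height f L (x', c * d) v \<le> cone_height f L (x', c * d) z"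
      using u by blast
    \<comment> \<open>The homothety with centre \<open>(y, 0)\<close> and factor \<open>c\<close> multiplies both sides of
      the critical point equation by \<open>c\<close>, so \<open>y\<close> is critical for the new point as well.\<close>
    have "f' y * dist (x', c * d) (y, 0) = c * (f' y * r)"
      unfolding dist_q by simp
    also have "\<dots> = L * (y - x')"
      unfolding crit x'_def by (simp add: algebra_simps)
    finally have "f' y * dist (x', c * d) (y, 0) = L * (y - x')" .
    moreover have "f' z * dist (x', c * d) (z, 0) = L * (z - x')"
      using f d'(1) z(2) by (rule highest_cone_critical)
    moreover have "c * d * L\<^sup>2 * K < (L\<^sup>2 - M\<^sup>2) powr (3/2)"
    proof -
      have "c * d * (L\<^sup>2 * K) \<le> d\<^sub>1 * (L\<^sup>2 * K)"
        using d' lipschitz_on_nonneg[OF K] by (intro mult_right_mono) auto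
      then show ?thesis using d\<^sub>1 by (simp add: mult.assoc)
    qed
    ultimately have "y = z"
      using K M d'(1) by (intro critical_vertex_unique[of K f' M L "c * d" y x' z]) auto
    then have "u (x', c * d) = f y - L * (c * r)"
      using z(1) dist_q by (simp only: cone_height_def)
    also have "\<dots> = u (x, d) + L * t"
      unfolding y(1) cone_height_def c(2) r_def[symmetric] by (simp add: algebra_simps)
    finally show ?case
      by (simp only: q)
  qed
  with norm_e show ?thesis by blast
qed

lemma lipschitz_on_lip_const:
  fixes g :: "real \<Rightarrow> real"
  assumes "\<exists>K. K-lipschitz_on UNIV g"
  shows "(lip_const g)-lipschitz_on UNIV g"
proof -
  let ?S = "{K. K-lipschitz_on UNIV g}"
  have S: "?S \<noteq> {}" using assms by simp
  show ?thesis
  proof (rule lipschitz_onI)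
    show "0 \<le> lip_const g"
      unfolding lip_const_def using S by (rule cInf_greatest) (simp add: lipschitz_on_def)
    show "dist (g x) (g y) \<le> lip_const g * dist x y" for x y
    proof (cases "x = y")
      case False
      have "dist (g x) (g y) / dist x y \<le> lip_const g"
        unfolding lip_const_def using S
        by (rule cInf_greatest) (use False in \<open>auto simp: divide_le_eq dest: lipschitz_onD\<close>)
      then show ?thesis
        using False by (simp add: divide_le_eq)
    qed simp
  qed
qed

lemma abs_le_sup_norm:
  assumes "bounded (range g)"
  shows "\<bar>g x\<bar> \<le> sup_norm g"
proof -
  obtain B where "\<And>x. \<bar>g x\<bar> \<le> B"
    using assms by (auto simp: bounded_iff)
  then show ?thesis
    unfolding sup_norm_def by (intro cSUP_upper bdd_aboveI2) auto
qed

theorem corollary3: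
  fixes f :: "real \<Rightarrow> real" and L L\<^sub>f L'\<^sub>f D \<delta> :: real and u :: "real \<times> real \<Rightarrow> real"
  assumes "C11 f"
    and "L\<^sub>f = sup_norm (deriv f)"
    and "L'\<^sub>f = lip_const (deriv f)"
    and "L > L\<^sub>f"
    and "D = 2 * L * L\<^sub>f / (L\<^sup>2 - L\<^sub>f\<^sup>2)"
    and "\<delta> > 0"
    and "\<delta> * L'\<^sub>f * (1 + D\<^sup>2) powr (3/2) < L"
    and "\<delta> * L\<^sup>2 * L'\<^sub>f < (L\<^sup>2 - L\<^sub>f\<^sup>2) powr (3/2)"
    and "\<And>x d. u (x, d) = (SUP y. f y - L * sqrt ((x - y)\<^sup>2 + d\<^sup>2))"
  shows "inf_harmonic_on {(x, d). 0 < d \<and> d < \<delta>} u"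
proof -
  have f: "(f has_real_derivative deriv f y) (at y)" for y
    using assms(1) by (simp add: C11_def DERIV_deriv_iff_real_differentiable)
  have f': "\<bar>deriv f y\<bar> \<le> L\<^sub>f" for y
    using assms(1,2) by (simp add: C11_def abs_le_sup_norm)
  have L\<^sub>f: "0 \<le> L\<^sub>f" using f'[of 0] by linarith
  then have L: "0 \<le> L" using assms(4) by simp
  have K: "L'\<^sub>f-lipschitz_on UNIV (deriv f)"
    using assms(1,3) by (simp add: C11_def lipschitz_on_lip_const)
  have f_lip: "L\<^sub>f-lipschitz_on UNIV f"
  proof (rule lipschitz_onI)
    show "dist (f x) (f y) \<le> L\<^sub>f * dist x y" for x y
      using field_differentiable_bound[of UNIV f "deriv f" L\<^sub>f x y] f f' by (simp add: dist_norm)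
  qed (rule L\<^sub>f)
  have u_eq: "u p = (SUP y. cone_height f L p y)" for p
    using assms(9)[of "fst p" "snd p"]
    by (cases p) (simp add: cone_height_def dist_Pair_Pair dist_real_def)
  have u_max: "\<exists>y. u p = cone_height f L p y \<and> (\<forall>z. cone_height f L p z \<le> cone_height f L p y)" for p
  proof -
    obtain y where y: "\<And>z. cone_height f L p z \<le> cone_height f L p y"
      using highest_cone_exists[OF f_lip assms(4)] by blast
    then have "u p = cone_height f L p y"
      unfolding u_eq by (intro cSup_eq_maximum) auto
    with y show ?thesis by blast
  qed
  have u_le: "u p \<le> u q + L * dist p q" for p q
  proof -
    obtain y z where "u p = cone_height f L p y" "u q = cone_height f L q z" "cone_height f L q y \<le> cone_height f L q z"
      using u_max by metis
    then show ?thesis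
      using cone_height_lipschitz[OF L, of f p y q] by linarith
  qed
  show ?thesis
  proof (rule inf_harmonic_on_if_maximal_slope_segments)
    have strip: "{(x, d). 0 < d \<and> d < \<delta>} = (UNIV :: real set) \<times> {0<..<\<delta>}"
      by auto
    show "open {(x :: real, d). 0 < d \<and> d < \<delta>}"
      unfolding strip by (intro open_Times) auto
    show "L-lipschitz_on UNIV u"
    proof (rule lipschitz_onI)
      show "dist (u p) (u q) \<le> L * dist p q" for p q
        using u_le[of p q] u_le[of q p] by (simp add: dist_real_def dist_commute abs_le_iff)
    qed (rule L)
    show "\<exists>e. norm e = 1 \<and> (\<forall>\<^sub>F t in nhds 0. u (p + t *\<^sub>R e) = u p + L * t)"
      if "p \<in> {(x, d). 0 < d \<and> d < \<delta>}" for p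
      using highest_cone_has_slope_segment[OF f K f' assms(4,8) _ _ u_max] that by auto
  qed
qed

end
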